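(* Let $\Delta$ and $\Gamma$ be groups. If the wreath product $\Delta \wr \Gamma$ is Hopfian, then $\Delta$ is Hopfian. If moreover $\Delta$ is abelian, then $\Gamma$ is Hopfian.
   Context: The (standard, restricted) wreath product of (discrete) groups is $\Delta \wr \Gamma := \left(\bigoplus_\Gamma \Delta\right) \rtimes \Gamma$, where $\bigoplus_\Gamma \Delta$ is the group of finitely supported functions $f\colon \Gamma \to \Delta$ under pointwise multiplication, and $\Gamma$ acts by shifting coordinates: $({}_\gamma f)(x) = f(\gamma^{-1}x)$. A group is Hopfian if every surjective endomorphism of it is an automorphism. *)

theory Defs
  imports "HOL-Algebra.Algebra"
begin

definition hopfian :: "('a, 'm) monoid_scheme \<Rightarrow> bool"
  where "hopfian G \<longleftrightarrow> (\<forall>f \<in> epi G G. f \<in> iso G G)"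

text \<open>
  \<open>\<phi> h\<close> is meant to be an automorphism of \<open>N\<close>, multiplicative in \<open>h\<close>; neither is enforced here.
\<close>
definition semidirect_product ::
    "('a, 'm) monoid_scheme \<Rightarrow> ('b, 'n) monoid_scheme \<Rightarrow> ('b \<Rightarrow> 'a \<Rightarrow> 'a) \<Rightarrow> ('a \<times> 'b) monoid"
  where "semidirect_product N H \<phi> =
    \<lparr>carrier = carrier N \<times> carrier H,
     monoid.mult = (\<lambda>(n, h) (n', h'). (n \<otimes>\<^bsub>N\<^esub> \<phi> h n', h \<otimes>\<^bsub>H\<^esub> h')),
     monoid.one = (\<one>\<^bsub>N\<^esub>, \<one>\<^bsub>H\<^esub>)\<rparr>"

definition shift :: "('b, 'n) monoid_scheme \<Rightarrow> 'b \<Rightarrow> ('b \<Rightarrow> 'a) \<Rightarrow> 'b \<Rightarrow> 'a"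
  where "shift \<Gamma> g f = (\<lambda>x\<in>carrier \<Gamma>. f (inv\<^bsub>\<Gamma>\<^esub> g \<otimes>\<^bsub>\<Gamma>\<^esub> x))"

text \<open>
  A function on the carrier of \<open>\<Gamma>\<close> is represented by its extension with value \<open>undefined\<close>
  outside the carrier, as \<^const>\<open>sum_group\<close> does.
\<close>
definition wreath_product ::
    "('a, 'm) monoid_scheme \<Rightarrow> ('b, 'n) monoid_scheme \<Rightarrow> (('b \<Rightarrow> 'a) \<times> 'b) monoid"
  where "wreath_product \<Delta> \<Gamma> =
    semidirect_product (sum_group (carrier \<Gamma>) (\<lambda>_. \<Delta>)) \<Gamma> (shift \<Gamma>)"

lemma group_semidirect_product:
  assumes N: "group N" and H: "group H"
    and hom: "\<And>h. h \<in> carrier H \<Longrightarrow> \<phi> h \<in> hom N N"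
    and one: "\<And>n. n \<in> carrier N \<Longrightarrow> \<phi> \<one>\<^bsub>H\<^esub> n = n"
    and mult: "\<And>h k n. \<lbrakk>h \<in> carrier H; k \<in> carrier H; n \<in> carrier N\<rbrakk>
      \<Longrightarrow> \<phi> (h \<otimes>\<^bsub>H\<^esub> k) n = \<phi> h (\<phi> k n)"
  shows "group (semidirect_product N H \<phi>)"
proof -
  interpret N: group N by (rule N)
  interpret H: group H by (rule H)
  have cl: "\<phi> h n \<in> carrier N" if "h \<in> carrier H" "n \<in> carrier N" for h n
    using hom[OF that(1)] that(2) by (auto simp: hom_def)
  have m: "\<phi> h (n \<otimes>\<^bsub>N\<^esub> k) = \<phi> h n \<otimes>\<^bsub>N\<^esub> \<phi> h k"
    if "h \<in> carrier H" "n \<in> carrier N" "k \<in> carrier N" for h n k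
    using hom[OF that(1)] that by (auto simp: hom_def)
  show ?thesis
  proof (rule groupI)
    fix x assume "x \<in> carrier (semidirect_product N H \<phi>)"
    then obtain n h where x: "x = (n, h)" "n \<in> carrier N" "h \<in> carrier H"
      by (auto simp: semidirect_product_def)
    let ?y = "(\<phi> (inv\<^bsub>H\<^esub> h) (inv\<^bsub>N\<^esub> n), inv\<^bsub>H\<^esub> h)"
    have "\<phi> (inv\<^bsub>H\<^esub> h) \<one>\<^bsub>N\<^esub> = \<one>\<^bsub>N\<^esub>"
      using hom_one[OF hom N N, of "inv\<^bsub>H\<^esub> h"] x by simp
    then have "?y \<otimes>\<^bsub>semidirect_product N H \<phi>\<^esub> x = \<one>\<^bsub>semidirect_product N H \<phi>\<^esub>"
      using x by (simp add: semidirect_product_def flip: m)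
    moreover have "?y \<in> carrier (semidirect_product N H \<phi>)"
      using x by (simp add: semidirect_product_def cl)
    ultimately show "\<exists>y\<in>carrier (semidirect_product N H \<phi>).
        y \<otimes>\<^bsub>semidirect_product N H \<phi>\<^esub> x = \<one>\<^bsub>semidirect_product N H \<phi>\<^esub>" by blast
  qed (auto simp: semidirect_product_def cl m mult one N.m_assoc H.m_assoc)
qed

lemma group_wreath_product:
  assumes "group \<Delta>" and "group \<Gamma>"
  shows "group (wreath_product \<Delta> \<Gamma>)"
proof -
  interpret D: group \<Delta> by (rule assms)
  interpret G: group \<Gamma> by (rule assms)
  let ?S = "sum_group (carrier \<Gamma>) (\<lambda>_. \<Delta>)"
  have car: "carrier ?S = {f \<in> carrier \<Gamma> \<rightarrow>\<^sub>E carrier \<Delta>. finite {x \<in> carrier \<Gamma>. f x \<noteq> \<one>\<^bsub>\<Delta>\<^esub>}}"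
    by (simp add: carrier_sum_group assms)
  have cl: "shift \<Gamma> g f \<in> carrier ?S" if g: "g \<in> carrier \<Gamma>" and f: "f \<in> carrier ?S" for g f
  proof -
    have "{x \<in> carrier \<Gamma>. shift \<Gamma> g f x \<noteq> \<one>\<^bsub>\<Delta>\<^esub>}
        \<subseteq> (\<lambda>x. g \<otimes>\<^bsub>\<Gamma>\<^esub> x) ` {x \<in> carrier \<Gamma>. f x \<noteq> \<one>\<^bsub>\<Delta>\<^esub>}"
    proof
      fix x assume x: "x \<in> {x \<in> carrier \<Gamma>. shift \<Gamma> g f x \<noteq> \<one>\<^bsub>\<Delta>\<^esub>}"
      then have "x = g \<otimes>\<^bsub>\<Gamma>\<^esub> (inv\<^bsub>\<Gamma>\<^esub> g \<otimes>\<^bsub>\<Gamma>\<^esub> x)"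
        using g by (simp flip: G.m_assoc)
      moreover have "inv\<^bsub>\<Gamma>\<^esub> g \<otimes>\<^bsub>\<Gamma>\<^esub> x \<in> {x \<in> carrier \<Gamma>. f x \<noteq> \<one>\<^bsub>\<Delta>\<^esub>}"
        using x g by (auto simp: shift_def)
      ultimately show "x \<in> (\<lambda>x. g \<otimes>\<^bsub>\<Gamma>\<^esub> x) ` {x \<in> carrier \<Gamma>. f x \<noteq> \<one>\<^bsub>\<Delta>\<^esub>}" by blast
    qed
    moreover have "finite {x \<in> carrier \<Gamma>. f x \<noteq> \<one>\<^bsub>\<Delta>\<^esub>}"
      using f unfolding car by blast
    ultimately have "finite {x \<in> carrier \<Gamma>. shift \<Gamma> g f x \<noteq> \<one>\<^bsub>\<Delta>\<^esub>}"
      using finite_surj by blast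
    moreover have "shift \<Gamma> g f \<in> carrier \<Gamma> \<rightarrow>\<^sub>E carrier \<Delta>"
      using f g unfolding car by (auto simp: shift_def)
    ultimately show ?thesis unfolding car by blast
  qed
  show ?thesis
    unfolding wreath_product_def
  proof (rule group_semidirect_product)
    show "shift \<Gamma> g \<in> hom ?S ?S" if "g \<in> carrier \<Gamma>" for g
      using that by (auto simp: hom_def cl) (auto simp: shift_def)
    show "shift \<Gamma> \<one>\<^bsub>\<Gamma>\<^esub> f = f" if "f \<in> carrier ?S" for f
      using that by (auto simp: car shift_def PiE_iff extensional_def)
    show "shift \<Gamma> (g \<otimes>\<^bsub>\<Gamma>\<^esub> k) f = shift \<Gamma> g (shift \<Gamma> k f)"
      if "g \<in> carrier \<Gamma>" "k \<in> carrier \<Gamma>" "f \<in> carrier ?S" for g k f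
      using that by (auto simp: shift_def G.inv_mult_group G.m_assoc)
  qed (simp_all add: assms)
qed

end

theory Submission
  imports Defs "HOL-Algebra.Free_Abelian_Groups"
begin

text \<open>
  A surjective endomorphism of one factor that is not injective extends to a surjective
  endomorphism of the whole wreath product that is not injective, so each factor inherits the
  Hopf property. In general, surjective endomorphisms \<open>p\<close> of \<open>N\<close> and \<open>a\<close> of \<open>H\<close> with
  \<open>p (\<phi> h n) = \<phi> (a h) (p n)\<close> combine into the surjective endomorphism \<open>(n, h) \<mapsto> (p n, a h)\<close> of
  \<open>N \<rtimes> H\<close>; if that one is injective, so are \<open>p\<close> and \<open>a\<close> (\<open>hopfian_semidirect_productD\<close>).

  For a surjective \<open>\<psi> : \<Delta> \<rightarrow> \<Delta>\<close>, take \<open>p f = \<psi> \<circ> f\<close> and \<open>a\<close> the identity: injectivity of \<open>p\<close>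
  on functions supported at one point is injectivity of \<open>\<psi>\<close>. For a surjective
  \<open>\<alpha> : \<Gamma> \<rightarrow> \<Gamma>\<close>, take \<open>a = \<alpha>\<close> and let \<open>p f\<close> multiply the values of \<open>f\<close> along the fibres of
  \<open>\<alpha>\<close>. Those products are finite but come without an order, and
  \<open>f \<mapsto> p f\<close> has to be multiplicative: this is where \<open>\<Delta>\<close> must be abelian.
  Equivariance holds because left translation by \<open>g\<close> carries the fibre over \<open>y\<close> onto the fibre
  over \<open>\<alpha> g \<cdot> y\<close>.
\<close>

lemma hopfian_semidirect_productD:
  assumes "monoid N" and "monoid H" and hopf: "hopfian (semidirect_product N H \<phi>)"
    and p: "p \<in> epi N N" and a: "a \<in> epi H H"
    and closed: "\<And>h n. \<lbrakk>h \<in> carrier H; n \<in> carrier N\<rbrakk> \<Longrightarrow> \<phi> h n \<in> carrier N"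
    and equivariant: "\<And>h n. \<lbrakk>h \<in> carrier H; n \<in> carrier N\<rbrakk> \<Longrightarrow> p (\<phi> h n) = \<phi> (a h) (p n)"
  shows "p \<in> iso N N" and "a \<in> iso H H"
proof -
  interpret N: monoid N by fact
  interpret H: monoid H by fact
  have homs: "p \<in> hom N N" "a \<in> hom H H"
    and surj: "p ` carrier N = carrier N" "a ` carrier H = carrier H"
    using p a by (auto simp: epi_def)
  let ?S = "semidirect_product N H \<phi>"
  have "map_prod p a \<in> epi ?S ?S"
    unfolding epi_def
  proof (intro CollectI conjI)
    show "map_prod p a \<in> hom ?S ?S"
      using homs by (auto simp: hom_def semidirect_product_def closed equivariant)
    show "map_prod p a ` carrier ?S = carrier ?S"
      using map_prod_surj_on[OF surj] by (simp add: semidirect_product_def)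
  qed
  then have inj: "inj_on (map_prod p a) (carrier N \<times> carrier H)"
    using hopf by (auto simp: hopfian_def iso_iff semidirect_product_def)
  have "inj_on p (carrier N)"
  proof (rule inj_onI)
    fix m n assume "m \<in> carrier N" "n \<in> carrier N" "p m = p n"
    then show "m = n"
      using inj_onD[OF inj, of "(m, \<one>\<^bsub>H\<^esub>)" "(n, \<one>\<^bsub>H\<^esub>)"] by simp
  qed
  moreover have "inj_on a (carrier H)"
  proof (rule inj_onI)
    fix g h assume "g \<in> carrier H" "h \<in> carrier H" "a g = a h"
    then show "g = h"
      using inj_onD[OF inj, of "(\<one>\<^bsub>N\<^esub>, g)" "(\<one>\<^bsub>N\<^esub>, h)"] by simp
  qed
  ultimately show "p \<in> iso N N" "a \<in> iso H H"
    using homs surj by (auto simp: iso_iff)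
qed

lemma shift_closed:
  assumes "group \<Delta>" and "group \<Gamma>"
    and g: "g \<in> carrier \<Gamma>" and f: "f \<in> carrier (sum_group (carrier \<Gamma>) (\<lambda>_. \<Delta>))"
  shows "shift \<Gamma> g f \<in> carrier (sum_group (carrier \<Gamma>) (\<lambda>_. \<Delta>))"
proof -
  interpret D: group \<Delta> by fact
  interpret G: group \<Gamma> by fact
  let ?supp = "{x \<in> carrier \<Gamma>. f x \<noteq> \<one>\<^bsub>\<Delta>\<^esub>}"
  have "{x \<in> carrier \<Gamma>. shift \<Gamma> g f x \<noteq> \<one>\<^bsub>\<Delta>\<^esub>} \<subseteq> (\<lambda>x. g \<otimes>\<^bsub>\<Gamma>\<^esub> x) ` ?supp"
  proof
    fix x assume x: "x \<in> {x \<in> carrier \<Gamma>. shift \<Gamma> g f x \<noteq> \<one>\<^bsub>\<Delta>\<^esub>}"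
    show "x \<in> (\<lambda>x. g \<otimes>\<^bsub>\<Gamma>\<^esub> x) ` ?supp"
      by (rule image_eqI[of _ _ "inv\<^bsub>\<Gamma>\<^esub> g \<otimes>\<^bsub>\<Gamma>\<^esub> x"])
        (use g x in \<open>auto simp: shift_def simp flip: G.m_assoc\<close>)
  qed
  moreover have "finite ?supp"
    using f by (simp add: carrier_sum_group assms)
  ultimately have "finite {x \<in> carrier \<Gamma>. shift \<Gamma> g f x \<noteq> \<one>\<^bsub>\<Delta>\<^esub>}"
    by (meson finite_imageI finite_subset)
  then show ?thesis
    using f g by (auto simp: carrier_sum_group assms shift_def PiE_iff)
qed

text \<open>
  Stated for any index set, since this is a property of direct sums alone: a surjection that
  sends \<open>\<one>\<close> to \<open>\<one>\<close> stays surjective on finitely supported families.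
\<close>
lemma epi_sum_group_postcompose:
  assumes "group \<Delta>" and \<psi>: "\<psi> \<in> epi \<Delta> \<Delta>"
  shows "(\<lambda>f. \<lambda>x\<in>I. \<psi> (f x)) \<in> epi (sum_group I (\<lambda>_. \<Delta>)) (sum_group I (\<lambda>_. \<Delta>))"
    (is "?p \<in> epi ?S ?S")
proof -
  interpret D: group \<Delta> by fact
  have hom: "\<psi> \<in> hom \<Delta> \<Delta>" and surj: "\<psi> ` carrier \<Delta> = carrier \<Delta>"
    using \<psi> by (auto simp: epi_def)
  have one: "\<psi> \<one>\<^bsub>\<Delta>\<^esub> = \<one>\<^bsub>\<Delta>\<^esub>"
    using hom_one[OF hom] assms by blast
  have car: "carrier ?S = {f \<in> I \<rightarrow>\<^sub>E carrier \<Delta>. finite {x \<in> I. f x \<noteq> \<one>\<^bsub>\<Delta>\<^esub>}}"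
    by (simp add: carrier_sum_group assms)
  have closed: "?p f \<in> carrier ?S" if f: "f \<in> carrier ?S" for f
  proof -
    have "{x \<in> I. ?p f x \<noteq> \<one>\<^bsub>\<Delta>\<^esub>} \<subseteq> {x \<in> I. f x \<noteq> \<one>\<^bsub>\<Delta>\<^esub>}"
      using one by auto
    then have "finite {x \<in> I. ?p f x \<noteq> \<one>\<^bsub>\<Delta>\<^esub>}"
      using f car finite_subset by blast
    then show ?thesis
      using f hom by (auto simp: car hom_def PiE_iff)
  qed
  have "?p \<in> hom ?S ?S"
  proof (rule homI)
    fix f g assume "f \<in> carrier ?S" "g \<in> carrier ?S"
    then show "?p (f \<otimes>\<^bsub>?S\<^esub> g) = ?p f \<otimes>\<^bsub>?S\<^esub> ?p g"
      using hom by (auto simp: car PiE_iff hom_mult intro!: restrict_ext)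
  qed (rule closed)
  moreover have "carrier ?S \<subseteq> ?p ` carrier ?S"
  proof
    fix h assume h: "h \<in> carrier ?S"
    \<comment> \<open>Pointwise preimages need not be finitely supported, unless \<open>\<one>\<close> is lifted to \<open>\<one>\<close>.\<close>
    define s where "s = (\<lambda>d. if d = \<one>\<^bsub>\<Delta>\<^esub> then \<one>\<^bsub>\<Delta>\<^esub> else inv_into (carrier \<Delta>) \<psi> d)"
    have s: "s d \<in> carrier \<Delta>" "\<psi> (s d) = d" if "d \<in> carrier \<Delta>" for d
      using that surj by (auto simp: s_def one inv_into_into f_inv_into_f)
    let ?f = "\<lambda>x\<in>I. s (h x)"
    have "{x \<in> I. ?f x \<noteq> \<one>\<^bsub>\<Delta>\<^esub>} \<subseteq> {x \<in> I. h x \<noteq> \<one>\<^bsub>\<Delta>\<^esub>}"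
      by (auto simp: s_def)
    then have "finite {x \<in> I. ?f x \<noteq> \<one>\<^bsub>\<Delta>\<^esub>}"
      using h car finite_subset by blast
    then have f: "?f \<in> carrier ?S"
      using h s by (auto simp: car PiE_iff)
    have "h = ?p ?f"
      using h s by (auto simp: car PiE_iff extensional_def)
    then show "h \<in> ?p ` carrier ?S"
      by (rule image_eqI[OF _ f])
  qed
  ultimately show ?thesis by (simp add: epi_iff_subset)
qed

lemma hopfian_wreath_product_base:
  assumes "group \<Delta>" and "group \<Gamma>" and hopf: "hopfian (wreath_product \<Delta> \<Gamma>)"
  shows "hopfian \<Delta>"
  unfolding hopfian_def
proof
  fix \<psi> assume \<psi>: "\<psi> \<in> epi \<Delta> \<Delta>"
  interpret D: group \<Delta> by fact
  interpret G: group \<Gamma> by fact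
  let ?S = "sum_group (carrier \<Gamma>) (\<lambda>_. \<Delta>)"
  let ?p = "\<lambda>f. \<lambda>x\<in>carrier \<Gamma>. \<psi> (f x)"
  have "?p \<in> iso ?S ?S"
  proof (rule hopfian_semidirect_productD(1))
    show "hopfian (semidirect_product ?S \<Gamma> (shift \<Gamma>))"
      using hopf by (simp add: wreath_product_def)
    show "?p \<in> epi ?S ?S"
      using epi_sum_group_postcompose[OF \<open>group \<Delta>\<close> \<psi>] .
    show "id \<in> epi \<Gamma> \<Gamma>"
      using id_iso iso_iff_mon_epi by blast
    show "?p (shift \<Gamma> g f) = shift \<Gamma> (id g) (?p f)" if "g \<in> carrier \<Gamma>" for g f
      using that by (auto simp: shift_def)
  qed (auto simp: assms shift_closed group.is_monoid)
  then have inj: "inj_on ?p (carrier ?S)" by (simp add: iso_iff)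
  define single where
    "single d = (\<lambda>x\<in>carrier \<Gamma>. if x = \<one>\<^bsub>\<Gamma>\<^esub> then d else \<one>\<^bsub>\<Delta>\<^esub>)" for d
  have single: "single d \<in> carrier ?S" if "d \<in> carrier \<Delta>" for d
  proof -
    have "{x \<in> carrier \<Gamma>. single d x \<noteq> \<one>\<^bsub>\<Delta>\<^esub>} \<subseteq> {\<one>\<^bsub>\<Gamma>\<^esub>}"
      by (auto simp: single_def)
    then have "finite {x \<in> carrier \<Gamma>. single d x \<noteq> \<one>\<^bsub>\<Delta>\<^esub>}"
      using finite_subset by blast
    then show ?thesis
      using that by (auto simp: carrier_sum_group assms single_def)
  qed
  have "inj_on \<psi> (carrier \<Delta>)"
  proof (rule inj_onI)
    fix c d assume cd: "c \<in> carrier \<Delta>" "d \<in> carrier \<Delta>" and "\<psi> c = \<psi> d"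
    then have "?p (single c) = ?p (single d)"
      by (auto simp: single_def)
    then have "single c = single d"
      by (rule inj_onD[OF inj]) (use cd single in auto)
    then have "single c \<one>\<^bsub>\<Gamma>\<^esub> = single d \<one>\<^bsub>\<Gamma>\<^esub>" by simp
    then show "c = d" by (simp add: single_def)
  qed
  then show "\<psi> \<in> iso \<Delta> \<Delta>"
    using \<psi> by (auto simp: iso_iff epi_def)
qed

text \<open>
  The pushforward of a finitely supported function along \<open>\<alpha>\<close>. Fibres may be infinite (a
  surjective endomorphism that is not injective can have an infinite kernel), so the product is
  \<^const>\<open>gfinprod\<close>, which multiplies only over the support.
\<close>
definition fibre_product ::
    "('a, 'm) monoid_scheme \<Rightarrow> 'b set \<Rightarrow> 'c set \<Rightarrow> ('b \<Rightarrow> 'c) \<Rightarrow> ('b \<Rightarrow> 'a) \<Rightarrow> 'c \<Rightarrow> 'a"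
  where "fibre_product \<Delta> I J \<alpha> f = (\<lambda>y\<in>J. gfinprod \<Delta> f {x \<in> I. \<alpha> x = y})"

text \<open>
  Multiplicativity is the rearrangement of a finite product of products, hence the commutativity
  of \<open>\<Delta>\<close>; the support of the pushforward lies in the image of the support.
\<close>
lemma epi_sum_group_fibre_product:
  assumes "comm_group \<Delta>" and surj: "\<alpha> ` I = J"
  shows "fibre_product \<Delta> I J \<alpha> \<in> epi (sum_group I (\<lambda>_. \<Delta>)) (sum_group J (\<lambda>_. \<Delta>))"
    (is "?p \<in> epi ?S ?T")
proof -
  interpret D: comm_group \<Delta> by fact
  have car: "carrier (sum_group K (\<lambda>_. \<Delta>)) =
      {f \<in> K \<rightarrow>\<^sub>E carrier \<Delta>. finite {x \<in> K. f x \<noteq> \<one>\<^bsub>\<Delta>\<^esub>}}" for K :: "'x set"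
    by (simp add: carrier_sum_group)
  have fin: "finite {x \<in> {x \<in> I. \<alpha> x = y}. f x \<noteq> \<one>\<^bsub>\<Delta>\<^esub>}" if "f \<in> carrier ?S" for f y
    by (rule finite_subset[of _ "{x \<in> I. f x \<noteq> \<one>\<^bsub>\<Delta>\<^esub>}"]) (use that car in auto)
  have val: "f \<in> {x \<in> I. \<alpha> x = y} \<rightarrow> carrier \<Delta>" if "f \<in> carrier ?S" for f y
    using that by (auto simp: car)
  have closed: "?p f \<in> carrier ?T" if f: "f \<in> carrier ?S" for f
  proof -
    have "{y \<in> J. ?p f y \<noteq> \<one>\<^bsub>\<Delta>\<^esub>} \<subseteq> \<alpha> ` {x \<in> I. f x \<noteq> \<one>\<^bsub>\<Delta>\<^esub>}"
    proof
      fix y assume y: "y \<in> {y \<in> J. ?p f y \<noteq> \<one>\<^bsub>\<Delta>\<^esub>}"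
      have "{x \<in> {x \<in> I. \<alpha> x = y}. f x \<noteq> \<one>\<^bsub>\<Delta>\<^esub>} \<noteq> {}"
      proof
        assume "{x \<in> {x \<in> I. \<alpha> x = y}. f x \<noteq> \<one>\<^bsub>\<Delta>\<^esub>} = {}"
        then have "gfinprod \<Delta> f {x \<in> I. \<alpha> x = y} = \<one>\<^bsub>\<Delta>\<^esub>"
          unfolding gfinprod_def by (simp only:) simp
        with y show False by (auto simp: fibre_product_def)
      qed
      then show "y \<in> \<alpha> ` {x \<in> I. f x \<noteq> \<one>\<^bsub>\<Delta>\<^esub>}" by auto
    qed
    then have "finite {y \<in> J. ?p f y \<noteq> \<one>\<^bsub>\<Delta>\<^esub>}"
      using f by (auto simp: car intro: finite_subset)
    then show ?thesis
      using val[OF f] by (simp add: car fibre_product_def)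
  qed
  have "?p \<in> hom ?S ?T"
  proof (rule homI)
    fix f g assume f: "f \<in> carrier ?S" and g: "g \<in> carrier ?S"
    have "gfinprod \<Delta> (f \<otimes>\<^bsub>?S\<^esub> g) {x \<in> I. \<alpha> x = y}
        = gfinprod \<Delta> f {x \<in> I. \<alpha> x = y} \<otimes>\<^bsub>\<Delta>\<^esub> gfinprod \<Delta> g {x \<in> I. \<alpha> x = y}" for y
    proof -
      have "gfinprod \<Delta> (f \<otimes>\<^bsub>?S\<^esub> g) {x \<in> I. \<alpha> x = y}
          = gfinprod \<Delta> (\<lambda>x. f x \<otimes>\<^bsub>\<Delta>\<^esub> g x) {x \<in> I. \<alpha> x = y}"
        using f g by (intro D.gfinprod_cong) (auto simp: car PiE_iff simp_implies_def)
      then show ?thesis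
        using D.gfinprod_distrib[OF fin[OF f] fin[OF g] val[OF f] val[OF g]] by simp
    qed
    then show "?p (f \<otimes>\<^bsub>?S\<^esub> g) = ?p f \<otimes>\<^bsub>?T\<^esub> ?p g"
      by (auto simp: fibre_product_def)
  qed (rule closed)
  moreover have "carrier ?T \<subseteq> ?p ` carrier ?S"
  proof
    fix h assume h: "h \<in> carrier ?T"
    \<comment> \<open>Concentrating \<open>h y\<close> at one chosen point of the fibre over \<open>y\<close> makes every fibre product
      a product of one factor.\<close>
    define s where "s = inv_into I \<alpha>"
    have s: "s y \<in> I" "\<alpha> (s y) = y" if "y \<in> J" for y
      using that surj by (auto simp: s_def inv_into_into f_inv_into_f)
    define f where "f = (\<lambda>x\<in>I. if x = s (\<alpha> x) then h (\<alpha> x) else \<one>\<^bsub>\<Delta>\<^esub>)"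
    have \<alpha>: "\<alpha> x \<in> J" if "x \<in> I" for x
      using that surj by blast
    have "{x \<in> I. f x \<noteq> \<one>\<^bsub>\<Delta>\<^esub>} \<subseteq> s ` {y \<in> J. h y \<noteq> \<one>\<^bsub>\<Delta>\<^esub>}"
      using \<alpha> by (auto simp: f_def split: if_splits)
    then have "finite {x \<in> I. f x \<noteq> \<one>\<^bsub>\<Delta>\<^esub>}"
      using h by (auto simp: car intro: finite_subset)
    then have f: "f \<in> carrier ?S"
      using h \<alpha> by (auto simp: car f_def PiE_iff)
    have "?p f y = h y" if y: "y \<in> J" for y
    proof -
      have fs: "f (s y) = h y" "h y \<in> carrier \<Delta>"
        using s[OF y] h y by (auto simp: f_def car)
      have "gfinprod \<Delta> f {x \<in> I. \<alpha> x = y} = gfinprod \<Delta> f {s y}"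
        by (rule D.gfinprod_mono_neutral_cong_right)
          (use s[OF y] val[OF f] in \<open>auto simp: f_def\<close>)
      then show ?thesis
        using y fs by (simp add: fibre_product_def)
    qed
    then have "?p f = h"
      using h by (auto simp: car fibre_product_def PiE_iff extensional_def)
    with f show "h \<in> ?p ` carrier ?S" by blast
  qed
  ultimately show ?thesis by (simp add: epi_iff_subset)
qed

lemma (in comm_group) gfinprod_reindex:
  assumes "inj_on t A" and "f \<in> t ` A \<rightarrow> carrier G"
  shows "gfinprod G f (t ` A) = gfinprod G (\<lambda>x. f (t x)) A"
proof -
  let ?B = "{x \<in> A. f (t x) \<noteq> \<one>}"
  have supp: "{y \<in> t ` A. f y \<noteq> \<one>} = t ` ?B" by auto
  have inj: "inj_on t ?B"
    using assms(1) by (auto intro: inj_on_subset)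
  have "finprod G f (t ` ?B) = finprod G (\<lambda>x. f (t x)) ?B"
    by (rule finprod_reindex) (use assms inj in auto)
  then show ?thesis
    using finite_image_iff[OF inj] by (simp add: gfinprod_def supp)
qed

text \<open>
  The value at \<open>y\<close> of the pushforward of the shifted function is a product of \<open>f (g\<inverse> x)\<close> over the
  fibre of \<open>y\<close>. Substituting \<open>x\<close> by \<open>g x\<close> makes it the product of \<open>f\<close> over the fibre of
  \<open>(\<alpha> g)\<inverse> y\<close>, because \<open>\<alpha>\<close> is a homomorphism.
\<close>
lemma fibre_product_shift:
  assumes "comm_group \<Delta>" and "group \<Gamma>" and "group \<Gamma>'" and \<alpha>: "\<alpha> \<in> hom \<Gamma> \<Gamma>'"
    and g: "g \<in> carrier \<Gamma>" and f: "f \<in> carrier \<Gamma> \<rightarrow> carrier \<Delta>"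
  shows "fibre_product \<Delta> (carrier \<Gamma>) (carrier \<Gamma>') \<alpha> (shift \<Gamma> g f) =
    shift \<Gamma>' (\<alpha> g) (fibre_product \<Delta> (carrier \<Gamma>) (carrier \<Gamma>') \<alpha> f)"
proof -
  interpret D: comm_group \<Delta> by fact
  interpret G: group \<Gamma> by fact
  interpret G': group \<Gamma>' by fact
  interpret \<alpha>: group_hom \<Gamma> \<Gamma>' \<alpha>
    using \<alpha> by unfold_locales
  have "gfinprod \<Delta> (shift \<Gamma> g f) {x \<in> carrier \<Gamma>. \<alpha> x = y} =
      gfinprod \<Delta> f {x \<in> carrier \<Gamma>. \<alpha> x = inv\<^bsub>\<Gamma>'\<^esub> \<alpha> g \<otimes>\<^bsub>\<Gamma>'\<^esub> y}"
    (is "gfinprod _ _ ?A = gfinprod _ _ ?B") if y: "y \<in> carrier \<Gamma>'" for y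
  proof -
    let ?t = "\<lambda>x. inv\<^bsub>\<Gamma>\<^esub> g \<otimes>\<^bsub>\<Gamma>\<^esub> x"
    have \<alpha>t: "\<alpha> (?t x) = inv\<^bsub>\<Gamma>'\<^esub> \<alpha> g \<otimes>\<^bsub>\<Gamma>'\<^esub> \<alpha> x" if "x \<in> carrier \<Gamma>" for x
      using that g by simp
    have "?B = ?t ` ?A"
    proof (intro equalityI subsetI)
      fix x assume x: "x \<in> ?B"
      have "g \<otimes>\<^bsub>\<Gamma>\<^esub> x \<in> ?A"
        using x g y by (simp flip: G'.m_assoc)
      moreover have "x = ?t (g \<otimes>\<^bsub>\<Gamma>\<^esub> x)"
        using x g by (simp flip: G.m_assoc)
      ultimately show "x \<in> ?t ` ?A" by blast
    qed (use g \<alpha>t in auto)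
    then have "gfinprod \<Delta> f ?B = gfinprod \<Delta> (\<lambda>x. f (?t x)) ?A"
      using D.gfinprod_reindex[of ?t ?A f] g f by (auto simp: inj_on_def)
    also have "\<dots> = gfinprod \<Delta> (shift \<Gamma> g f) ?A"
      by (rule D.gfinprod_cong) (use f g in \<open>auto simp: shift_def simp_implies_def\<close>)
    finally show ?thesis by simp
  qed
  then show ?thesis
    using g by (auto simp: fibre_product_def shift_def[of \<Gamma>'])
qed

lemma hopfian_wreath_product_top:
  assumes "comm_group \<Delta>" and "group \<Gamma>" and hopf: "hopfian (wreath_product \<Delta> \<Gamma>)"
  shows "hopfian \<Gamma>"
  unfolding hopfian_def
proof
  fix \<alpha> assume \<alpha>: "\<alpha> \<in> epi \<Gamma> \<Gamma>"
  interpret D: comm_group \<Delta> by fact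
  let ?S = "sum_group (carrier \<Gamma>) (\<lambda>_. \<Delta>)"
  let ?p = "fibre_product \<Delta> (carrier \<Gamma>) (carrier \<Gamma>) \<alpha>"
  show "\<alpha> \<in> iso \<Gamma> \<Gamma>"
  proof (rule hopfian_semidirect_productD(2))
    show "hopfian (semidirect_product ?S \<Gamma> (shift \<Gamma>))"
      using hopf by (simp add: wreath_product_def)
    show "?p \<in> epi ?S ?S"
      using \<alpha> by (intro epi_sum_group_fibre_product assms) (simp add: epi_def)
    show "?p (shift \<Gamma> g f) = shift \<Gamma> (\<alpha> g) (?p f)"
      if "g \<in> carrier \<Gamma>" "f \<in> carrier ?S" for g f
      using that \<alpha> by (intro fibre_product_shift assms) (auto simp: epi_def carrier_sum_group)
  qed (auto simp: assms \<alpha> shift_closed group.is_monoid)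
qed

theorem proposition1p2:
  fixes \<Delta> :: "('a, 'm) monoid_scheme"
    and \<Gamma> :: "('b, 'n) monoid_scheme"
  assumes "group \<Delta>" and "group \<Gamma>"
    and "hopfian (wreath_product \<Delta> \<Gamma>)"
  shows "hopfian \<Delta> \<and> (comm_group \<Delta> \<longrightarrow> hopfian \<Gamma>)"
  using hopfian_wreath_product_base[OF assms] hopfian_wreath_product_top assms(2,3) by blast

end
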